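(* There is an absolute constant $c>0$ such that the following holds. Let $\vec c_1,\dots,\vec c_l\in\mathbb{R}_+^n$ be vectors each having at most $d$ non-zero coordinates, where $d\ge2$. Define $\vec\lambda:\mathbb{R}_+^n\to\mathbb{R}_+^l$ by $\lambda_k(\vec x)=\langle\vec c_k,\vec x\rangle$ for $k\in[l]$. Let $p\ge2$ and $f(\vec x)=\sum_{k\in[l]}\lambda_k(\vec x)^p$. Then there is a $(c\,p\log d)^p$-competitive online algorithm for online convex covering with cost function $f$. Equivalently, there is a $(c\,p\log d)$-competitive online algorithm for online convex covering with cost function $\|\vec\lambda(\vec x)\|_p$.
   Context: Online convex covering problem with cost function $f:\mathbb{R}_+^n\to\mathbb{R}_+$: the number $n$ and the function $f$ are known in advance. The algorithm maintains $\vec x\in\mathbb{R}_+^n$ whose coordinates may only increase over time. In round $j=1,\dots,m$ a nonzero vector $\vec a_j\in\mathbb{R}_+^n$ arrives (possibly chosen adversarially depending on the algorithm's past responses), and the algorithm must immediately, without knowledge of future vectors (or of $m$), increase coordinates of $\vec x$ so that $\langle\vec a_j,\vec x\rangle\ge 1$. Let $C^{\mathrm{opt}}$ be the minimum of the cost over all $\vec x\in\mathbb{R}_+^n$ with $\langle\vec a_j,\vec x\rangle\ge1$ for all $j\in[m]$. The algorithm is $\alpha$-competitive if for every instance its final vector has cost at most $\alpha\cdot C^{\mathrm{opt}}$. *)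

theory Defs
  imports Complex_Main "Jordan_Normal_Form.Matrix"
begin

text \<open>
  Points of the nonnegative orthant are dimension-indexed vectors rather than elements of a type
  \<open>real ^ 'n\<close>: the absolute constant of the theorem is chosen before the dimension, so the dimension
  has to be a term that can be quantified inside the statement.
\<close>

definition nonneg_vec :: "nat \<Rightarrow> real vec set" where
  "nonneg_vec n = {x \<in> carrier_vec n. 0\<^sub>v n \<le> x}"

definition covering_instance :: "nat \<Rightarrow> real vec list \<Rightarrow> bool" where
  "covering_instance n as \<longleftrightarrow> (\<forall>a \<in> set as. a \<in> nonneg_vec n \<and> a \<noteq> 0\<^sub>v n)"

definition covering_feasible :: "nat \<Rightarrow> real vec list \<Rightarrow> real vec set" where
  "covering_feasible n as = {x \<in> nonneg_vec n. \<forall>a \<in> set as. 1 \<le> a \<bullet> x}"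

text \<open>
  The minimum of the cost is written as an infimum. For an instance the feasible set is nonempty and
  costs are nonnegative, so this is a genuine infimum; it equals the
  minimum, which is attained for the costs considered here.
\<close>

definition opt_cost :: "nat \<Rightarrow> (real vec \<Rightarrow> real) \<Rightarrow> real vec list \<Rightarrow> real" where
  "opt_cost n f as = (INF x \<in> covering_feasible n as. f x)"

text \<open>
  A deterministic online algorithm maps the requests \<open>[a\<^sub>1, \<dots>, a\<^sub>j]\<close> seen so far to the vector held
  after round \<open>j\<close>; \<open>A []\<close> is the initial vector. Since it only sees the prefix, it knows neither
  the future requests nor their number. The past responses are determined by the past requests, so
  quantifying over all request lists also covers adaptive adversaries.
\<close>

definition online_covering_algorithm :: "nat \<Rightarrow> (real vec list \<Rightarrow> real vec) \<Rightarrow> bool" where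
  "online_covering_algorithm n A \<longleftrightarrow>
     A [] \<in> nonneg_vec n \<and>
     (\<forall>as a. covering_instance n (as @ [a]) \<longrightarrow>
        A (as @ [a]) \<in> nonneg_vec n \<and>
        A as \<le> A (as @ [a]) \<and>
        1 \<le> a \<bullet> A (as @ [a]))"

definition competitive ::
  "nat \<Rightarrow> (real vec \<Rightarrow> real) \<Rightarrow> real \<Rightarrow> (real vec list \<Rightarrow> real vec) \<Rightarrow> bool" where
  "competitive n f \<alpha> A \<longleftrightarrow>
     (\<forall>as. covering_instance n as \<longrightarrow> f (A as) \<le> \<alpha> * opt_cost n f as)"

definition linear_loads :: "nat \<Rightarrow> (nat \<Rightarrow> real vec) \<Rightarrow> real vec \<Rightarrow> real vec" where
  "linear_loads l c x = vec l (\<lambda>k. c k \<bullet> x)"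

definition p_norm :: "real \<Rightarrow> real vec \<Rightarrow> real" where
  "p_norm p v = (\<Sum>k<dim_vec v. \<bar>v $ k\<bar> powr p) powr (1 / p)"

end

theory Submission
  imports Defs
begin

text \<open>
  Primal-dual argument. The dual certificate is a total weight \<open>Y = \<Sum>\<^sub>j y\<^sub>j\<close> with
  \<open>\<Sum>\<^sub>j a\<^sub>j\<^sub>i y\<^sub>j \<le> \<Sum>\<^sub>k c\<^sub>k\<^sub>i \<psi>(c\<^sub>k\<^sub>i x\<^sub>i, \<lambda>\<^sub>k(x))\<close>, where
  \<open>\<psi>(u, L) = L\<^sup>p\<^sup>-\<^sup>1 O(log d)\<close> increases at rate at least
  \<open>L\<^sup>p\<^sup>-\<^sup>1 / (3 max(u, \<epsilon>L))\<close> when \<open>u\<close> and \<open>L\<close> grow together, \<open>\<epsilon> = 1 / (2pd)\<close>. Raising \<open>x\<^sub>i\<close>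
  proportionally to \<open>a\<^sub>i\<close> divided by the corresponding rate therefore pays for the dual increase,
  while the cost grows by \<open>O(1)\<close> per unit of dual value, except for the growth of those
  parts \<open>c\<^sub>k\<^sub>i x\<^sub>i\<close> that are below \<open>\<epsilon>\<lambda>\<^sub>k\<close>; as row \<open>k\<close> has at most \<open>d\<close> such parts, they are
  negligible. Capping \<open>u/L\<close> at \<open>1/p\<close> in \<open>\<psi>\<close> is what gives \<open>log d\<close> instead of \<open>log (pd)\<close>:
  beyond \<open>u = L/p\<close> the increase of \<open>L\<^sup>p\<^sup>-\<^sup>1\<close> itself suffices.
  Small enough steps have a uniform positive length during one request, so finitely many of them
  serve it and no differential equation is needed.
\<close>

section \<open>Elementary inequalities and a common step length\<close>

lemma powr_diff_bounds:
  fixes a b q :: real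
  assumes "0 < a" "a \<le> b" "1 \<le> q"
  shows "q * a powr (q - 1) * (b - a) \<le> b powr q - a powr q"
    and "b powr q - a powr q \<le> q * b powr (q - 1) * (b - a)"
proof -
  have "q * a powr (q - 1) * (b - a) \<le> b powr q - a powr q \<and>
        b powr q - a powr q \<le> q * b powr (q - 1) * (b - a)"
  proof (cases "a = b")
    case False
    with assms have "a < b" by simp
    then obtain z where z: "a < z" "z < b"
      and eq: "b powr q - a powr q = (b - a) * (q * z powr (q - 1))"
      using MVT2[of a b "\<lambda>x. x powr q" "\<lambda>x. q * x powr (q - 1)"] assms(1)
        has_real_derivative_powr by (metis less_le_trans)
    have "a powr (q - 1) \<le> z powr (q - 1)" "z powr (q - 1) \<le> b powr (q - 1)"
      using z assms by (auto intro: powr_mono2)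
    then have "(b - a) * (q * a powr (q - 1)) \<le> (b - a) * (q * z powr (q - 1))"
      "(b - a) * (q * z powr (q - 1)) \<le> (b - a) * (q * b powr (q - 1))"
      using z assms by (auto intro!: mult_left_mono)
    then show ?thesis unfolding eq by (simp add: mult_ac)
  qed simp
  then show "q * a powr (q - 1) * (b - a) \<le> b powr q - a powr q"
    and "b powr q - a powr q \<le> q * b powr (q - 1) * (b - a)" by auto
qed

text \<open>Bernoulli's inequality with exponent \<open>L' / L\<close> gives
  \<open>1 + t / L \<le> (1 + t / L') powr (L' / L)\<close>; take logarithms. This is what later
  offsets the decrease of the logarithm in \<open>psi\<close> when the load grows.\<close>

lemma mult_ln_add_one_divide_mono:
  fixes t L L' :: real
  assumes "0 \<le> t" "0 < L" "L \<le> L'"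
  shows "L * ln (1 + t / L) \<le> L' * ln (1 + t / L')"
proof -
  let ?q = "L' / L" and ?b = "1 + t / L'"
  have q: "1 \<le> ?q" using assms by simp
  have b: "1 \<le> ?b" using assms by simp
  have "?q * (t / L') \<le> ?b powr ?q - 1"
    using powr_diff_bounds(1)[of 1 ?b ?q] q b by simp
  moreover have "?q * (t / L') = t / L" using assms by (simp add: field_simps)
  ultimately have "1 + t / L \<le> ?b powr ?q" by simp
  moreover have "0 < 1 + t / L" using assms by (simp add: add_pos_nonneg)
  ultimately have "ln (1 + t / L) \<le> ln (?b powr ?q)" by (subst ln_le_cancel_iff) auto
  also have "\<dots> = ?q * ln ?b" using b by (simp add: ln_powr)
  finally have "L * ln (1 + t / L) \<le> L * (?q * ln ?b)"
    using assms by (intro mult_left_mono) auto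
  also have "\<dots> = L' * ln ?b" using assms by simp
  finally show ?thesis .
qed

text \<open>A crude form of Young's inequality: replace both factors by their maximum.\<close>

lemma powr_mult_le_add_powr:
  fixes a b p :: real
  assumes "0 \<le> a" "0 \<le> b" "1 \<le> p"
  shows "a powr (p - 1) * b \<le> a powr p + b powr p"
proof -
  let ?m = "max a b"
  have "a powr (p - 1) * b \<le> ?m powr (p - 1) * ?m"
    using assms by (intro mult_mono powr_mono2) auto
  also have "\<dots> = ?m powr p"
    using assms powr_add[of ?m "p - 1" 1] by (cases "?m = 0") auto
  also have "\<dots> \<le> a powr p + b powr p" by (auto simp: max_def)
  finally show ?thesis .
qed

text \<open>Finitely many linear constraints with positive right-hand sides all hold for one small
  positive step length.\<close>

lemma finite_scaling:
  fixes B R :: "'a \<Rightarrow> real"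
  assumes "finite K" "\<And>k. k \<in> K \<Longrightarrow> 0 < B k"
  shows "\<exists>t>0. \<forall>k\<in>K. R k * t \<le> B k"
  using assms
proof (induction K rule: finite_induct)
  case empty
  show ?case by (intro exI[of _ 1]) simp
next
  case (insert k K)
  then obtain t where t: "0 < t" "\<forall>j\<in>K. R j * t \<le> B j" by auto
  \<comment> \<open>The summand 1 keeps the divisor positive when \<open>R k\<close> is 0.\<close>
  let ?t = "min t (B k / (\<bar>R k\<bar> + 1))"
  have Bk: "0 < B k" and B: "\<And>j. j \<in> K \<Longrightarrow> 0 < B j" using insert.prems by auto
  have pos: "0 < ?t" using t Bk by (simp add: add_nonneg_pos)
  have "R j * ?t \<le> B j" if "j \<in> K" for j
  proof (cases "0 \<le> R j")
    case True
    then have "R j * ?t \<le> R j * t" by (intro mult_left_mono) auto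
    then show ?thesis using t that by force
  next
    case False
    then have "R j * ?t \<le> 0" using pos by (simp add: mult_nonpos_nonneg)
    then show ?thesis using B[OF that] by linarith
  qed
  moreover have "R k * ?t \<le> B k"
  proof -
    have "R k * ?t \<le> (\<bar>R k\<bar> + 1) * ?t" using pos by (intro mult_right_mono) auto
    also have "\<dots> \<le> (\<bar>R k\<bar> + 1) * (B k / (\<bar>R k\<bar> + 1))" by (intro mult_left_mono) auto
    also have "\<dots> = B k" by (simp add: add_nonneg_pos)
    finally show ?thesis .
  qed
  ultimately show ?case using pos by (intro exI[of _ ?t]) auto
qed

section \<open>Loads, cost and the functions of the primal-dual analysis\<close>

locale power_load =
  fixes n l d :: nat and c :: "nat \<Rightarrow> nat \<Rightarrow> real" and p :: real
  assumes d_ge_2: "2 \<le> d" and p_ge_2: "2 \<le> p"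
    and c_nonneg: "\<And>k i. k < l \<Longrightarrow> i < n \<Longrightarrow> 0 \<le> c k i"
    and sparse: "\<And>k. k < l \<Longrightarrow> card {i. i < n \<and> c k i \<noteq> 0} \<le> d"
begin

text \<open>Chosen so that \<open>d\<close> parts of size \<open>eps * L\<close> add up to
  \<open>L / (2 * p)\<close>, and so that the cap \<open>1 / p\<close> in \<open>psi\<close> is
  \<open>2 * real d\<close> times \<open>eps\<close>.\<close>

definition eps :: real where "eps = 1 / (2 * p * real d)"

definition load :: "nat \<Rightarrow> (nat \<Rightarrow> real) \<Rightarrow> real" where
  "load k x = (\<Sum>i<n. c k i * x i)"

definition cost :: "(nat \<Rightarrow> real) \<Rightarrow> real" where
  "cost x = (\<Sum>k<l. load k x powr p)"

text \<open>Below the cap, the logarithm is an antiderivative in \<open>u\<close> of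
  \<open>1 / (u + eps * L)\<close>. The summand 2 makes the growth of \<open>L powr (p - 1)\<close>
  alone sufficient once \<open>u\<close> is at least \<open>L / (2 * p)\<close>.\<close>

definition psi :: "real \<Rightarrow> real \<Rightarrow> real" where
  "psi u L = L powr (p - 1) * (2 + ln (1 + min (u / L) (1 / p) / eps))"

definition dual_load :: "nat \<Rightarrow> (nat \<Rightarrow> real) \<Rightarrow> real" where
  "dual_load i x = (\<Sum>k<l. c k i * psi (c k i * x i) (load k x))"

text \<open>
  The subtracted sum is at most half of the first term, and it absorbs the growth of the parts
  below \<open>eps\<close> times the load.
\<close>

definition gain1 :: "nat \<Rightarrow> (nat \<Rightarrow> real) \<Rightarrow> real" where
  "gain1 k x = load k x powr p / p
     - (\<Sum>i<n. min (load k x powr (p - 1) * (c k i * x i)) (eps * load k x powr p))"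

definition gain :: "(nat \<Rightarrow> real) \<Rightarrow> real" where
  "gain x = (\<Sum>k<l. gain1 k x)"

section \<open>Bounds, monotonicity and growth of \<open>psi\<close>\<close>

lemma eps_pos: "0 < eps"
  using d_ge_2 p_ge_2 by (simp add: eps_def)

lemma eps_le: "eps \<le> 1 / (2 * p)"
  using d_ge_2 p_ge_2 by (simp add: eps_def field_simps)

lemma psi_nonneg:
  assumes "0 \<le> u" "0 \<le> L"
  shows "0 \<le> psi u L"
  unfolding psi_def using assms eps_pos p_ge_2
  by (intro mult_nonneg_nonneg add_nonneg_nonneg ln_ge_zero) auto

lemma psi_le:
  assumes "0 \<le> u" "0 \<le> L"
  shows "psi u L \<le> L powr (p - 1) * (2 + ln (1 + 2 * real d))"
proof -
  have "min (u / L) (1 / p) / eps \<le> (1 / p) / eps"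
    using eps_pos by (intro divide_right_mono) auto
  also have "\<dots> = 2 * real d" using p_ge_2 by (simp add: eps_def)
  finally have le: "1 + min (u / L) (1 / p) / eps \<le> 1 + 2 * real d" by simp
  have "0 \<le> min (u / L) (1 / p) / eps" using assms eps_pos p_ge_2 by auto
  then have "0 < 1 + min (u / L) (1 / p) / eps" by linarith
  with le have "ln (1 + min (u / L) (1 / p) / eps) \<le> ln (1 + 2 * real d)" by simp
  then show ?thesis unfolding psi_def by (intro mult_left_mono) auto
qed

text \<open>Growth of the load lowers \<open>u / L\<close> and hence the logarithm. One factor
  \<open>L\<close> taken from \<open>L powr (p - 1)\<close> makes up for this, and the remaining
  \<open>L powr (p - 2)\<close> is nondecreasing because \<open>p \<ge> 2\<close>.\<close>

lemma psi_mono_load: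
  assumes "0 \<le> u" "0 < L" "L \<le> L'"
  shows "psi u L \<le> psi u L'"
proof -
  have split: "psi u K = 2 * K powr (p - 1)
      + K powr (p - 2) * (K * ln (1 + (min u (K / p) / eps) / K))" if "0 < K" for K
  proof -
    have "min (u / K) (1 / p) = min u (K / p) / K"
      using that by (auto simp: min_def field_simps)
    moreover have "K powr (p - 1) = K powr (p - 2) * K"
      using that powr_add[of K "p - 2" 1] by simp
    ultimately show ?thesis by (simp add: psi_def algebra_simps)
  qed
  let ?m = "min u (L / p) / eps" and ?m' = "min u (L' / p) / eps"
  have m: "0 \<le> ?m" using assms eps_pos p_ge_2 by auto
  have "L / p \<le> L' / p" using assms p_ge_2 by (simp add: divide_right_mono)
  then have mm: "?m \<le> ?m'" using eps_pos by (intro divide_right_mono) auto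
  have "L * ln (1 + ?m / L) \<le> L' * ln (1 + ?m / L')"
    by (rule mult_ln_add_one_divide_mono[OF m assms(2,3)])
  also have "\<dots> \<le> L' * ln (1 + ?m' / L')"
  proof (intro mult_left_mono)
    have "0 \<le> ?m / L'" using divide_nonneg_nonneg[OF m, of L'] assms by simp
    then have "0 < 1 + ?m / L'" by linarith
    moreover have "1 + ?m / L' \<le> 1 + ?m' / L'"
      using divide_right_mono[OF mm, of L'] assms by simp
    ultimately show "ln (1 + ?m / L') \<le> ln (1 + ?m' / L')" by simp
  qed (use assms in auto)
  finally have *: "L * ln (1 + ?m / L) \<le> L' * ln (1 + ?m' / L')" .
  have "0 \<le> L * ln (1 + ?m / L)"
    using divide_nonneg_nonneg[OF m, of L] assms by (intro mult_nonneg_nonneg ln_ge_zero) auto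
  then have "L powr (p - 2) * (L * ln (1 + ?m / L)) \<le> L' powr (p - 2) * (L' * ln (1 + ?m' / L'))"
    using assms p_ge_2 by (intro mult_mono[OF _ *] powr_mono2) auto
  moreover have "L powr (p - 1) \<le> L' powr (p - 1)"
    using assms p_ge_2 by (intro powr_mono2) auto
  ultimately show ?thesis using split[of L] split[of L'] assms by simp
qed

text \<open>For \<open>u \<ge> L / (2 * p)\<close> the logarithm does not decrease and the increase
  of \<open>L powr (p - 1)\<close> suffices. Otherwise the cap is inactive before and after the
  increment, and the logarithm grows fast enough at the old load \<open>L\<close>; the rest is
  monotonicity in the load.\<close>

lemma psi_increment:
  assumes "0 \<le> u" "u \<le> L" "0 < L" "0 \<le> v" "v \<le> max u (eps * L)" "L + v \<le> L'"
  shows "L powr (p - 1) * v / (3 * max u (eps * L)) \<le> psi (u + v) L' - psi u L"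
proof -
  let ?w = "max u (eps * L)"
  have w: "0 < ?w" using eps_pos assms by (simp add: less_max_iff_disj)
  show ?thesis
  proof (cases "L / (2 * p) \<le> u")
    case True
    have u: "0 < u" using True assms p_ge_2 by (smt (verit) divide_pos_pos)
    have "min (u / L) (1 / p) \<le> min ((u + v) / (L + v)) (1 / p)"
    proof -
      \<comment> \<open>Adding the same \<open>v\<close> to both parts of a fraction that is at most
        1 does not decrease it.\<close>
      have "u * v \<le> L * v" using assms by (intro mult_right_mono) auto
      then have "u / L \<le> (u + v) / (L + v)" using assms by (simp add: field_simps)
      then show ?thesis by auto
    qed
    then have ln: "ln (1 + min (u / L) (1 / p) / eps) \<le> ln (1 + min ((u + v) / (L + v)) (1 / p) / eps)"
      (is "?A \<le> ?B")
      using assms eps_pos p_ge_2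
      by (subst ln_le_cancel_iff) (auto intro!: divide_right_mono add_pos_nonneg)
    have A: "0 \<le> ?A" using assms eps_pos p_ge_2 by (intro ln_ge_zero) auto
    have pw: "L powr (p - 1) \<le> (L + v) powr (p - 1)" using assms p_ge_2 by (intro powr_mono2) auto
    have "(p - 1) * L powr (p - 2) * v \<le> (L + v) powr (p - 1) - L powr (p - 1)"
      using powr_diff_bounds(1)[of L "L + v" "p - 1"] assms p_ge_2 by simp
    moreover have "L powr (p - 1) * ?A \<le> (L + v) powr (p - 1) * ?B"
      using pw ln A by (intro mult_mono) auto
    ultimately have "2 * ((p - 1) * L powr (p - 2) * v) \<le> psi (u + v) (L + v) - psi u L"
      unfolding psi_def by (simp add: algebra_simps)
    also have "\<dots> \<le> psi (u + v) L' - psi u L"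
      using psi_mono_load[of "u + v" "L + v" L'] assms by simp
    finally have *: "2 * (p - 1) * (L powr (p - 2) * v) \<le> psi (u + v) L' - psi u L"
      by (simp only: mult.assoc)
    have "L powr (p - 1) * v / (3 * ?w) \<le> L powr (p - 1) * v / (3 * (L / (2 * p)))"
      using True assms p_ge_2 w by (intro divide_left_mono mult_pos_pos) auto
    also have "\<dots> = (2 * p / 3) * (L powr (p - 2) * v)"
      using assms p_ge_2 powr_add[of L "p - 2" 1] by simp
    \<comment> \<open>Here \<open>2 * p / 3 \<le> 2 * (p - 1)\<close> follows from
      \<open>p \<ge> 2\<close>.\<close>
    also have "\<dots> \<le> 2 * (p - 1) * (L powr (p - 2) * v)"
      using assms p_ge_2 by (intro mult_right_mono) auto
    finally show ?thesis using * by simp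
  next
    case False
    have epsL: "eps * L \<le> L / (2 * p)"
      using mult_right_mono[OF eps_le, of L] assms by simp
    have "?w \<le> L / (2 * p)" using False epsL by auto
    then have "u + v \<le> L / (2 * p) + L / (2 * p)" using False assms(5) by linarith
    also have "\<dots> = L / p" by simp
    finally have "u + v \<le> L / p" .
    then have m1: "min ((u + v) / L) (1 / p) = (u + v) / L"
      using assms p_ge_2 by (intro min_absorb1) (simp add: field_simps)
    have "u \<le> L / p" using \<open>u + v \<le> L / p\<close> assms by linarith
    then have "u / L \<le> 1 / p" using assms p_ge_2 by (simp add: field_simps)
    then have m2: "min (u / L) (1 / p) = u / L" by (intro min_absorb1)
    let ?a = "1 + u / L / eps" and ?b = "1 + (u + v) / L / eps"
    have a: "0 < ?a" and b: "0 < ?b" using assms eps_pos by (auto intro!: add_pos_nonneg)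
    have "ln (?a / ?b) \<le> ?a / ?b - 1" using a b by (intro ln_le_minus_one) simp
    then have ln: "1 - ?a / ?b \<le> ln ?b - ln ?a" using a b by (simp add: ln_div)
    have "1 - ?a / ?b = v / (eps * L + u + v)"
    proof -
      have K: "0 < eps * L" using assms eps_pos by simp
      have "?a = (eps * L + u) / (eps * L)" "?b = (eps * L + u + v) / (eps * L)"
        using assms eps_pos by (simp_all add: field_simps)
      then have "?a / ?b = (eps * L + u) / (eps * L + u + v)" using assms eps_pos by simp
      also have "1 - \<dots> = v / (eps * L + u + v)" using K assms by (simp add: field_simps)
      finally show ?thesis .
    qed
    \<comment> \<open>Each of the three summands of the right denominator is at most
      \<open>?w\<close>; this is the origin of the constant 3.\<close>
    moreover have "v / (3 * ?w) \<le> v / (eps * L + u + v)"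
      using assms eps_pos w by (intro divide_left_mono mult_pos_pos add_pos_nonneg) auto
    ultimately have "v / (3 * ?w) \<le> ln ?b - ln ?a" using ln by simp
    then have "L powr (p - 1) * (v / (3 * ?w)) \<le> L powr (p - 1) * (ln ?b - ln ?a)"
      by (intro mult_left_mono) auto
    also have "\<dots> = psi (u + v) L - psi u L"
      unfolding psi_def m1 m2 by (simp add: algebra_simps)
    also have "\<dots> \<le> psi (u + v) L' - psi u L"
      using psi_mono_load[of "u + v" L L'] assms by simp
    finally show ?thesis by simp
  qed
qed

section \<open>Loads and the growth of the corrected cost \<open>gain\<close>\<close>

lemma load_mono:
  assumes "k < l" "\<And>i. i < n \<Longrightarrow> x i \<le> y i"
  shows "load k x \<le> load k y"
  unfolding load_def using assms c_nonneg by (intro sum_mono mult_left_mono) auto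

lemma load_nonneg:
  assumes "k < l" "\<And>i. i < n \<Longrightarrow> 0 \<le> x i"
  shows "0 \<le> load k x"
  unfolding load_def using assms c_nonneg by (intro sum_nonneg mult_nonneg_nonneg) auto

lemma part_le_load:
  assumes "k < l" "i < n" "\<And>i. i < n \<Longrightarrow> 0 \<le> x i"
  shows "c k i * x i \<le> load k x"
  unfolding load_def using assms c_nonneg
  by (intro member_le_sum[of i "{..<n}" "\<lambda>i. c k i * x i"]) auto

lemma load_add: "load k (\<lambda>i. x i + s i) = load k x + load k s"
  by (simp add: load_def sum.distrib distrib_left)

lemma gain1_le:
  assumes "k < l" "\<And>i. i < n \<Longrightarrow> 0 \<le> x i"
  shows "gain1 k x \<le> load k x powr p / p"
  unfolding gain1_def using assms c_nonneg eps_pos by (auto intro!: sum_nonneg)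

text \<open>By sparsity at most \<open>d\<close> terms of the subtracted sum are nonzero, and each
  is at most \<open>eps\<close> times the power of the load.\<close>

lemma gain1_ge:
  assumes "k < l" "\<And>i. i < n \<Longrightarrow> 0 \<le> x i"
  shows "load k x powr p / (2 * p) \<le> gain1 k x"
proof -
  let ?L = "load k x" and ?S = "{i. i < n \<and> c k i \<noteq> 0}"
  let ?t = "\<lambda>i. min (?L powr (p - 1) * (c k i * x i)) (eps * ?L powr p)"
  have "(\<Sum>i<n. ?t i) = (\<Sum>i\<in>?S. ?t i)"
    using eps_pos by (intro sum.mono_neutral_right) auto
  also have "\<dots> \<le> (\<Sum>i\<in>?S. eps * ?L powr p)" by (intro sum_mono) auto
  also have "\<dots> = real (card ?S) * (eps * ?L powr p)" by simp
  also have "\<dots> \<le> real d * (eps * ?L powr p)"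
    using sparse[OF assms(1)] eps_pos by (intro mult_right_mono) auto
  also have "\<dots> = ?L powr p / (2 * p)" using d_ge_2 by (simp add: eps_def)
  finally show ?thesis unfolding gain1_def using p_ge_2 by (simp add: field_simps)
qed

text \<open>The leading term charges every part at full rate, the bound only a fraction
  \<open>u / max u (eps * L)\<close> of it, where \<open>u\<close> is the part and \<open>L\<close>
  the load. For \<open>2 * u \<ge> eps * L\<close> this fraction is at least 1/2. For smaller parts
  the growth of the subtracted minimum cancels the charge. The constant 4 combines the 2 of
  \<open>double\<close> with this 1/2.\<close>

lemma gain1_increment:
  assumes k: "k < l" and x: "\<And>i. i < n \<Longrightarrow> 0 \<le> x i" and s: "\<And>i. i < n \<Longrightarrow> 0 \<le> s i"
    and pos: "0 < load k x"
    and small: "\<And>i. i < n \<Longrightarrow> 2 * (c k i * s i) \<le> max (c k i * x i) (eps * load k x)"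
    and double: "load k (\<lambda>i. x i + s i) powr (p - 1) \<le> 2 * load k x powr (p - 1)"
  shows "gain1 k (\<lambda>i. x i + s i) - gain1 k x \<le>
    4 * (\<Sum>i<n. load k x powr (p - 1) * (c k i * s i) * (c k i * x i)
            / max (c k i * x i) (eps * load k x))"
proof -
  let ?L = "load k x" and ?L' = "load k (\<lambda>i. x i + s i)"
  let ?u = "\<lambda>i. c k i * x i" and ?v = "\<lambda>i. c k i * s i"
  let ?P = "?L powr (p - 1)" and ?P' = "?L' powr (p - 1)"
  let ?t = "\<lambda>i. min (?P * ?u i) (eps * ?L powr p)"
  let ?t' = "\<lambda>i. min (?P' * (?u i + ?v i)) (eps * ?L' powr p)"
  have LL: "?L \<le> ?L'" by (rule load_mono[OF k]) (use s in auto)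
  have PP: "?P \<le> ?P'" using LL pos p_ge_2 by (intro powr_mono2) auto
  have PQ: "?L powr p \<le> ?L' powr p" using LL pos p_ge_2 by (intro powr_mono2) auto
  have "?L' powr p - ?L powr p \<le> p * ?P' * (?L' - ?L)"
    using powr_diff_bounds(2)[of ?L ?L' p] LL pos p_ge_2 by simp
  also have "?L' - ?L = (\<Sum>i<n. ?v i)" by (simp add: load_add load_def[of k s])
  also have "p * ?P' * (\<Sum>i<n. ?v i) = p * (\<Sum>i<n. ?P' * ?v i)"
    by (simp only: sum_distrib_left[symmetric] mult.assoc)
  finally have main: "?L' powr p / p - ?L powr p / p \<le> (\<Sum>i<n. ?P' * ?v i)"
    using p_ge_2 by (simp add: field_simps)
  have each: "?P' * ?v i - (?t' i - ?t i) \<le> 4 * (?P * ?v i * ?u i / max (?u i) (eps * ?L))"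
    if i: "i < n" for i
  proof -
    have u: "0 \<le> ?u i" and v: "0 \<le> ?v i" using i x s c_nonneg[OF k i] by auto
    have m: "0 < max (?u i) (eps * ?L)" using eps_pos pos by (simp add: less_max_iff_disj)
    show ?thesis
    proof (cases "2 * ?u i < eps * ?L")
      case True
      \<comment> \<open>The part stays below the threshold during the step, so the minimum is still
        its first argument afterwards.\<close>
      have "?u i + ?v i \<le> eps * ?L" using small[OF i] True u by auto
      also have "\<dots> \<le> eps * ?L'" using LL eps_pos by simp
      finally have uv: "?u i + ?v i \<le> eps * ?L'" .
      have pw: "K powr p = K powr (p - 1) * K" if "0 < K" for K :: real
        using that powr_add[of K "p - 1" 1] by simp
      have "?P' * (?u i + ?v i) \<le> ?P' * (eps * ?L')" using uv by (intro mult_left_mono) auto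
      also have "\<dots> = eps * ?L' powr p" using pw[of ?L'] LL pos by simp
      finally have t': "?t' i = ?P' * (?u i + ?v i)" by (intro min_absorb1)
      have "?t i \<le> ?P * ?u i" by simp
      also have "\<dots> \<le> ?P' * ?u i" using PP u by (intro mult_right_mono)
      finally have "?P' * ?v i - (?t' i - ?t i) \<le> 0" unfolding t' by (simp add: distrib_left)
      also have "0 \<le> 4 * (?P * ?v i * ?u i / max (?u i) (eps * ?L))"
        using mult_nonneg_nonneg[OF v u] m by (simp add: mult.assoc)
      finally show ?thesis .
    next
      case False
      \<comment> \<open>For a large part it is enough that the subtracted minimum does not
        decrease.\<close>
      have m2: "max (?u i) (eps * ?L) \<le> 2 * ?u i" using False u by (intro max.boundedI) linarith+
      have "?P * ?u i \<le> ?P' * (?u i + ?v i)" using PP u v by (intro mult_mono) auto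
      moreover have "eps * ?L powr p \<le> eps * ?L' powr p" using PQ eps_pos by simp
      ultimately have "?t i \<le> ?t' i" by (auto simp: min_le_iff_disj)
      then have "?P' * ?v i - (?t' i - ?t i) \<le> ?P' * ?v i" by simp
      also have "\<dots> \<le> 2 * ?P * ?v i" using double v by (intro mult_right_mono)
      also have "\<dots> = 2 * (?P * ?v i) * 1" by simp
      also have "\<dots> \<le> 2 * (?P * ?v i) * (2 * (?u i / max (?u i) (eps * ?L)))"
      proof (intro mult_left_mono)
        show "1 \<le> 2 * (?u i / max (?u i) (eps * ?L))"

          using pos_le_divide_eq[OF m, of 1 "2 * ?u i"] m2 by (simp only: mult_1_left times_divide_eq_right)
      qed (use v in auto)
      also have "\<dots> = 4 * (?P * ?v i * ?u i / max (?u i) (eps * ?L))" by simp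
      finally show ?thesis .
    qed
  qed
  have "gain1 k (\<lambda>i. x i + s i) - gain1 k x
      = (?L' powr p / p - ?L powr p / p) - (\<Sum>i<n. ?t' i - ?t i)"
    by (simp add: gain1_def sum_subtractf distrib_left)
  also have "\<dots> \<le> (\<Sum>i<n. ?P' * ?v i) - (\<Sum>i<n. ?t' i - ?t i)" using main by simp
  also have "\<dots> = (\<Sum>i<n. ?P' * ?v i - (?t' i - ?t i))" by (simp add: sum_subtractf)
  also have "\<dots> \<le> (\<Sum>i<n. 4 * (?P * ?v i * ?u i / max (?u i) (eps * ?L)))"
    by (intro sum_mono each) auto
  finally show ?thesis by (simp add: sum_distrib_left)
qed


section \<open>Rates of the dual load\<close>

text \<open>The other coordinates enter no load, so a request with a positive entry at one of them
  can be served there for free.\<close>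

definition costly :: "nat \<Rightarrow> bool" where
  "costly i \<longleftrightarrow> (\<exists>k<l. c k i \<noteq> 0)"

text \<open>
  The rate of the dual load is \<open>slope i x x\<close>; separate arguments for numerators and denominators
  make it monotone in the first and antitone in the second, which bounds it along a whole request.
\<close>

definition slope :: "nat \<Rightarrow> (nat \<Rightarrow> real) \<Rightarrow> (nat \<Rightarrow> real) \<Rightarrow> real" where
  "slope i x y = (\<Sum>k<l. c k i *
     (load k x powr (p - 1) * c k i / max (c k i * y i) (eps * load k y)))"

lemma load_pos:
  assumes "k < l" "i < n" "c k i \<noteq> 0" "\<And>i. i < n \<Longrightarrow> 0 \<le> x i" "0 < x i"
  shows "0 < load k x"
proof -
  have "0 < c k i * x i" using assms c_nonneg[of k i] by simp
  also have "\<dots> \<le> load k x" by (rule part_le_load) (use assms in auto)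
  finally show ?thesis .
qed

lemma slope_mono:
  assumes i: "i < n"
    and "\<And>i. i < n \<Longrightarrow> 0 \<le> x i" "\<And>i. i < n \<Longrightarrow> x i \<le> x' i"
    and "\<And>i. i < n \<Longrightarrow> 0 \<le> y' i" "\<And>i. i < n \<Longrightarrow> y' i \<le> y i" "0 < y' i"
  shows "slope i x y \<le> slope i x' y'"
  unfolding slope_def
proof (intro sum_mono)
  fix k assume "k \<in> {..<l}"
  then have k: "k < l" by simp
  show "c k i * (load k x powr (p - 1) * c k i / max (c k i * y i) (eps * load k y))
    \<le> c k i * (load k x' powr (p - 1) * c k i / max (c k i * y' i) (eps * load k y'))"
  proof (cases "c k i = 0")
    case False
    have lx: "0 \<le> load k x" "load k x \<le> load k x'" "load k y' \<le> load k y"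
      using assms k by (auto intro: load_nonneg load_mono)
    have "0 < c k i * y' i" using False assms k c_nonneg[of k i] by simp
    moreover have "c k i * y' i \<le> c k i * y i" using assms k c_nonneg[of k i]
      by (intro mult_left_mono) auto
    moreover have "eps * load k y' \<le> eps * load k y" using lx eps_pos by simp
    moreover have "load k x powr (p - 1) \<le> load k x' powr (p - 1)"
      using lx p_ge_2 by (intro powr_mono2) auto
    ultimately show ?thesis using c_nonneg[OF k i]
      by (intro mult_left_mono frac_le mult_right_mono mult_nonneg_nonneg) auto
  qed simp
qed

lemma slope_pos:
  assumes i: "i < n" "costly i"
    and x: "\<And>i. i < n \<Longrightarrow> 0 \<le> x i" "0 < x i" and y: "\<And>i. i < n \<Longrightarrow> 0 \<le> y i" "0 < y i"
  shows "0 < slope i x y"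
proof -
  obtain k where k: "k < l" "c k i \<noteq> 0" using i by (auto simp: costly_def)
  have ck: "0 < c k i" using k c_nonneg[of k i] i by simp
  have "0 < load k x" using load_pos[of k i x] k i x by auto
  moreover have "0 < c k i * y i" using ck y by simp
  ultimately have "0 < c k i * (load k x powr (p - 1) * c k i / max (c k i * y i) (eps * load k y))"
    using ck by (simp add: less_max_iff_disj)
  moreover have "0 \<le> c j i * (load j x powr (p - 1) * c j i / max (c j i * y i) (eps * load j y))"
    if "j < l" for j
  proof -
    have "0 \<le> c j i * y i" using c_nonneg[OF that i(1)] y by simp
    then have "0 \<le> max (c j i * y i) (eps * load j y)" by simp
    then show ?thesis using c_nonneg[OF that i(1)]
      by (intro mult_nonneg_nonneg divide_nonneg_nonneg) auto
  qed
  ultimately show ?thesis unfolding slope_def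
    using k by (intro sum_pos2[of _ k]) auto
qed

section \<open>Serving one request by finitely many small steps\<close>

text \<open>The 3 in \<open>s i\<close> cancels the 3 in \<open>psi_increment\<close>, so the dual
  load grows by at least \<open>a i * t\<close>. In the growth of \<open>gain\<close> the rates
  cancel, leaving \<open>4 * 3 * t\<close> times the coverage of the request, which is at most
  1.\<close>

lemma primal_dual_step:
  fixes a z s :: "nat \<Rightarrow> real" and t :: real
  assumes s_def: "\<And>i. i < n \<Longrightarrow> s i = 3 * a i * t / slope i z z"
    and z: "\<And>i. i < n \<Longrightarrow> 0 \<le> z i" and zpos: "\<And>i. i < n \<Longrightarrow> costly i \<Longrightarrow> 0 < z i"
    and a: "\<And>i. i < n \<Longrightarrow> 0 \<le> a i" and a0: "\<And>i. i < n \<Longrightarrow> \<not> costly i \<Longrightarrow> a i = 0"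
    and t: "0 \<le> t" and az: "(\<Sum>i<n. a i * z i) \<le> 1"
    and small: "\<And>k i. k < l \<Longrightarrow> i < n \<Longrightarrow> 2 * (c k i * s i) \<le> eps * load k z"
    and double: "\<And>k. k < l \<Longrightarrow> load k (\<lambda>i. z i + s i) powr (p - 1) \<le> 2 * load k z powr (p - 1)"
  shows "\<And>i. i < n \<Longrightarrow> a i * t \<le> dual_load i (\<lambda>i. z i + s i) - dual_load i z"
    and "gain (\<lambda>i. z i + s i) - gain z \<le> 12 * t"
proof -
  let ?z' = "\<lambda>i. z i + s i"
  have slope: "0 < slope i z z" if "i < n" "costly i" for i
    using slope_pos[of i z z] that z zpos by auto
  have s: "0 \<le> s i" if "i < n" for i
    using slope[of i] a[of i] a0[of i] t that by (cases "costly i") (auto simp: s_def)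
  \<comment> \<open>For a coordinate that is not costly the rate is 0, but then \<open>a i\<close>
    and \<open>s i\<close> vanish as well and the equation persists.\<close>
  have s_slope: "s i * slope i z z = 3 * a i * t" if "i < n" for i
    using slope[of i] a0[of i] that by (cases "costly i") (auto simp: s_def)
  have load_z: "0 < load k z" if "k < l" "i < n" "c k i \<noteq> 0" for k i
    using load_pos[of k i z] that z zpos by (auto simp: costly_def)
  show "a i * t \<le> dual_load i ?z' - dual_load i z" if i: "i < n" for i
  proof -
    have each: "c k i * (load k z powr (p - 1) * c k i / max (c k i * z i) (eps * load k z)) * (s i / 3)
      \<le> c k i * psi (c k i * ?z' i) (load k ?z') - c k i * psi (c k i * z i) (load k z)"
      if k: "k < l" for k
    proof (cases "c k i = 0")
      case False
      let ?u = "c k i * z i" and ?v = "c k i * s i" and ?L = "load k z" and ?L' = "load k ?z'"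
      have L: "0 < ?L" using load_z k i False by blast
      have v: "0 \<le> ?v" using s i c_nonneg k by simp
      have "?v \<le> load k s" by (rule part_le_load) (use k i s in auto)
      then have LL: "?L + ?v \<le> ?L'" by (simp add: load_add)
      have "?v \<le> eps * ?L" using small[OF k i] v by simp
      then have "?L powr (p - 1) * ?v / (3 * max ?u (eps * ?L)) \<le> psi (?u + ?v) ?L' - psi ?u ?L"
        using c_nonneg[OF k i] z[OF i] part_le_load[OF k i, of z] z L v LL
        by (intro psi_increment) (auto simp: le_max_iff_disj)
      then have "c k i * (?L powr (p - 1) * ?v / (3 * max ?u (eps * ?L)))
          \<le> c k i * (psi (?u + ?v) ?L' - psi ?u ?L)"
        using c_nonneg[OF k i] by (intro mult_left_mono)
      then show ?thesis by (simp add: algebra_simps)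
    qed simp
    have "a i * t = slope i z z * (s i / 3)" using s_slope[OF i] by (simp add: mult.commute)
    also have "\<dots> \<le> dual_load i ?z' - dual_load i z"
      unfolding slope_def dual_load_def sum_distrib_right sum_subtractf[symmetric]
      by (intro sum_mono each) auto
    finally show ?thesis .
  qed
  have each: "gain1 k ?z' - gain1 k z \<le>
    4 * (\<Sum>i<n. load k z powr (p - 1) * (c k i * s i) * (c k i * z i) / max (c k i * z i) (eps * load k z))"
    if k: "k < l" for k
  proof (cases "\<exists>i<n. c k i \<noteq> 0")
    case True
    then have L: "0 < load k z" using load_z k by blast
    show ?thesis
      using small[OF k] double[OF k] k z s L
      by (intro gain1_increment) (auto simp: le_max_iff_disj)
  next
    case False
    then show ?thesis by (simp add: gain1_def load_def)
  qed
  have "gain ?z' - gain z \<le> (\<Sum>k<l. 4 * (\<Sum>i<n. load k z powr (p - 1) * (c k i * s i) * (c k i * z i)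
      / max (c k i * z i) (eps * load k z)))"
    unfolding gain_def sum_subtractf[symmetric] by (intro sum_mono each) auto
  also have "\<dots> = 4 * (\<Sum>i<n. \<Sum>k<l. load k z powr (p - 1) * (c k i * s i) * (c k i * z i)
      / max (c k i * z i) (eps * load k z))"
    by (subst sum.swap) (simp only: sum_distrib_left)
  \<comment> \<open>Summed over the rows, the charge of coordinate \<open>i\<close> is
    \<open>z i * s i\<close> times exactly the rate by which \<open>s i\<close> was divided.\<close>
  also have "\<dots> = 4 * (\<Sum>i<n. z i * (s i * slope i z z))"
    unfolding slope_def sum_distrib_left by (simp add: mult_ac)
  also have "\<dots> = 4 * (\<Sum>i<n. 3 * t * (a i * z i))"
    by (intro arg_cong[of _ _ "\<lambda>x. 4 * x"] sum.cong) (auto simp: s_slope)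
  also have "\<dots> = 12 * t * (\<Sum>i<n. a i * z i)" by (simp add: sum_distrib_left mult_ac)
  also have "\<dots> \<le> 12 * t * 1" using az t by (intro mult_left_mono) auto
  finally show "gain ?z' - gain z \<le> 12 * t" by simp
qed

text \<open>Until the request is served, the current vector \<open>z\<close> lies between
  \<open>x\<close> and a fixed bound \<open>b\<close>. The rates then lie between two positive
  constants, which gives one step length \<open>t\<close> and one amount of progress
  \<open>\<rho>\<close> for all such \<open>z\<close>.\<close>

lemma uniform_step:
  fixes a x :: "nat \<Rightarrow> real"
  assumes x: "\<And>i. i < n \<Longrightarrow> 0 \<le> x i" and xpos: "\<And>i. i < n \<Longrightarrow> costly i \<Longrightarrow> 0 < x i"
    and a: "\<And>i. i < n \<Longrightarrow> 0 \<le> a i" and a0: "\<And>i. i < n \<Longrightarrow> \<not> costly i \<Longrightarrow> a i = 0"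
    and aex: "\<exists>i<n. a i \<noteq> 0"
  shows "\<exists>t>0. \<exists>\<rho>>0. \<forall>z. (\<forall>i<n. x i \<le> z i \<and> (a i = 0 \<longrightarrow> z i = x i)) \<longrightarrow>
      (\<Sum>i<n. a i * z i) < 1 \<longrightarrow>
      (\<exists>z'. (\<forall>i<n. z i \<le> z' i \<and> (a i = 0 \<longrightarrow> z' i = x i)) \<and>
        (\<Sum>i<n. a i * z i) + \<rho> \<le> (\<Sum>i<n. a i * z' i) \<and>
        (\<forall>i<n. a i * t \<le> dual_load i z' - dual_load i z) \<and> gain z' - gain z \<le> 12 * t)"
proof -
  \<comment> \<open>While the coverage is below 1, no single term \<open>a i * z i\<close> can reach
    1; coordinates with \<open>a i = 0\<close> are not moved.\<close>
  define b where "b i = (if a i = 0 then x i else max (x i) (1 / a i))" for i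
  \<comment> \<open>Scaling a load by \<open>1 + \<gamma>\<close> exactly doubles its power with
    exponent \<open>p - 1\<close>.\<close>
  define \<gamma> where "\<gamma> = 2 powr (1 / (p - 1)) - (1::real)"
  have \<gamma>: "0 < \<gamma>" using p_ge_2 by (simp add: \<gamma>_def)
  have xb: "x i \<le> b i" for i by (simp add: b_def)
  have b: "0 \<le> b i" if "i < n" for i using x[OF that] xb[of i] by linarith
  have bpos: "0 < b i" if "i < n" "costly i" for i using xpos[OF that] xb[of i] by linarith
  have lo: "0 < slope i x b" and hi: "0 < slope i b x" if "i < n" "costly i" for i
    using that x xpos b bpos by (auto intro!: slope_pos)
  define R where "R k = (\<Sum>i<n. c k i * (3 * a i / slope i x b))" for k
  have R: "0 \<le> c k i * (3 * a i / slope i x b)" if "k < l" "i < n" for k i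
    using that c_nonneg a a0 lo by (cases "costly i") (auto intro!: mult_nonneg_nonneg divide_nonneg_pos)
  \<comment> \<open>Rows whose load at \<open>x\<close> is 0 can be left out: all costly coordinates
    of \<open>x\<close> are positive, so such a row is identically 0.\<close>
  obtain t where t: "0 < t"
    and tR: "\<And>k. k < l \<Longrightarrow> load k x > 0 \<Longrightarrow> R k * t \<le> min \<gamma> (eps / 2) * load k x"
  proof -
    obtain t where "0 < t" "\<forall>k\<in>{k. k < l \<and> load k x > 0}. R k * t \<le> min \<gamma> (eps / 2) * load k x"
      using finite_scaling[of "{k. k < l \<and> load k x > 0}" "\<lambda>k. min \<gamma> (eps / 2) * load k x" R]
        \<gamma> eps_pos by auto
    then show thesis by (intro that) auto
  qed
  define \<rho> where "\<rho> = (\<Sum>i<n. a i * (3 * a i * t / slope i b x))"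
  have \<rho>: "0 < \<rho>"
  proof -
    obtain i where i: "i < n" "a i \<noteq> 0" using aex by blast
    have "0 < a i" "costly i" using i a[of i] a0[of i] by auto
    then have "0 < a i * (3 * a i * t / slope i b x)" using hi[of i] i t by simp
    moreover have "0 \<le> a j * (3 * a j * t / slope j b x)" if "j < n" for j
      using that a a0 hi[of j] t by (cases "costly j") (auto intro!: mult_nonneg_nonneg divide_nonneg_pos)
    ultimately show ?thesis unfolding \<rho>_def using i by (intro sum_pos2[of _ i]) auto
  qed
  show ?thesis
  proof (rule exI[of _ t], rule conjI, rule t, rule exI[of _ \<rho>], rule conjI, rule \<rho>, intro allI impI)
    fix z :: "nat \<Rightarrow> real"
    assume xzx: "\<forall>i<n. x i \<le> z i \<and> (a i = 0 \<longrightarrow> z i = x i)"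
    then have xz: "\<And>i. i < n \<Longrightarrow> x i \<le> z i" and zx: "\<And>i. i < n \<Longrightarrow> a i = 0 \<Longrightarrow> z i = x i"
      by auto
    assume az: "(\<Sum>i<n. a i * z i) < 1"
    have z: "0 \<le> z i" if "i < n" for i using x[OF that] xz[OF that] by linarith
    have zpos: "0 < z i" if "i < n" "costly i" for i using xpos[OF that] xz[OF that(1)] by linarith
    have zb: "z i \<le> b i" if i: "i < n" for i
    proof (cases "a i = 0")
      case False
      have "a i * z i \<le> (\<Sum>i<n. a i * z i)"
        using a z i by (intro member_le_sum[of i "{..<n}" "\<lambda>i. a i * z i"]) auto
      then have "a i * z i \<le> 1" using az by simp
      then have "z i \<le> 1 / a i" using False a[OF i] by (simp add: field_simps)
      then show ?thesis using False by (simp add: b_def)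
    qed (use zx i in \<open>simp add: b_def\<close>)
    define s where "s = (\<lambda>i. 3 * a i * t / slope i z z)"
    have slope_le: "slope i x b \<le> slope i z z" "slope i z z \<le> slope i b x"
      if "i < n" "costly i" for i
      using that x xz z zb b xpos zpos by (auto intro!: slope_mono)
    have s0: "0 \<le> s i" and s_le: "s i \<le> 3 * a i / slope i x b * t"
      and s_ge: "3 * a i * t / slope i b x \<le> s i" if i: "i < n" for i
    proof -
      have "0 \<le> s i \<and> s i \<le> 3 * a i / slope i x b * t \<and> 3 * a i * t / slope i b x \<le> s i"
      proof (cases "costly i")
        case True
        have "0 \<le> 3 * a i * t" using a[OF i] t by simp
        then show ?thesis using slope_le[OF i True] lo[OF i True] hi[OF i True]
          by (auto simp: s_def intro!: divide_left_mono divide_nonneg_pos)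
      qed (use i a0 in \<open>simp add: s_def\<close>)
      then show "0 \<le> s i" "s i \<le> 3 * a i / slope i x b * t" "3 * a i * t / slope i b x \<le> s i" by auto
    qed
    have load_s: "load k s \<le> min \<gamma> (eps / 2) * load k z" if k: "k < l" for k
    proof (cases "\<exists>i<n. c k i \<noteq> 0")
      case True
      then have pos: "0 < load k x" using load_pos[of k _ x] x xpos k by (auto simp: costly_def)
      have "load k s \<le> R k * t"
        unfolding load_def R_def sum_distrib_right
      proof (intro sum_mono)
        fix i assume "i \<in> {..<n}"
        then have "c k i * s i \<le> c k i * (3 * a i / slope i x b * t)"
          using s_le[of i] c_nonneg[OF k, of i] by (intro mult_left_mono) auto
        then show "c k i * s i \<le> c k i * (3 * a i / slope i x b) * t" by simp
      qed
      also have "\<dots> \<le> min \<gamma> (eps / 2) * load k x" by (rule tR[OF k pos])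
      also have "\<dots> \<le> min \<gamma> (eps / 2) * load k z"
        using \<gamma> eps_pos load_mono[OF k xz] by (intro mult_left_mono) auto
      finally show ?thesis .
    qed (simp add: load_def)
    have lz: "0 \<le> load k z" if "k < l" for k using load_nonneg[OF that z] .
    have small: "2 * (c k i * s i) \<le> eps * load k z" if "k < l" "i < n" for k i
    proof -
      have "c k i * s i \<le> load k s" by (rule part_le_load) (use that s0 in auto)
      also have "\<dots> \<le> min \<gamma> (eps / 2) * load k z" by (rule load_s[OF that(1)])
      also have "\<dots> \<le> eps / 2 * load k z" using lz[OF that(1)] by (intro mult_right_mono) auto
      finally show ?thesis by simp
    qed
    have double: "load k (\<lambda>i. z i + s i) powr (p - 1) \<le> 2 * load k z powr (p - 1)" if k: "k < l" for k
    proof -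
      have "load k s \<le> \<gamma> * load k z"
        using load_s[OF k] lz[OF k] by (meson mult_right_mono min.cobounded1 order_trans)
      then have "load k (\<lambda>i. z i + s i) \<le> 2 powr (1 / (p - 1)) * load k z"
        by (simp add: load_add \<gamma>_def algebra_simps)
      then have "load k (\<lambda>i. z i + s i) powr (p - 1) \<le> (2 powr (1 / (p - 1)) * load k z) powr (p - 1)"
        using p_ge_2 lz[OF k] load_nonneg[OF k s0] by (intro powr_mono2) (auto simp: load_add)
      also have "\<dots> = 2 * load k z powr (p - 1)"
        using p_ge_2 lz[OF k] by (simp add: powr_mult powr_powr)
      finally show ?thesis .
    qed
    note step = primal_dual_step[of s a t z, OF _ z zpos a a0 _ _ small double]
    have "\<rho> \<le> (\<Sum>i<n. a i * s i)"
      unfolding \<rho>_def using a s_ge by (intro sum_mono mult_left_mono) auto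
    then have "(\<Sum>i<n. a i * z i) + \<rho> \<le> (\<Sum>i<n. a i * (z i + s i))"
      by (simp add: sum.distrib distrib_left)
    moreover have "\<forall>i<n. a i * t \<le> dual_load i (\<lambda>i. z i + s i) - dual_load i z"
      using step(1) t az s_def by auto
    moreover have "gain (\<lambda>i. z i + s i) - gain z \<le> 12 * t"
      using step(2) t az s_def by auto
    moreover have "\<forall>i<n. a i = 0 \<longrightarrow> z i + s i = x i" using zx by (auto simp: s_def)
    ultimately show "\<exists>z'. (\<forall>i<n. z i \<le> z' i \<and> (a i = 0 \<longrightarrow> z' i = x i)) \<and>
        (\<Sum>i<n. a i * z i) + \<rho> \<le> (\<Sum>i<n. a i * z' i) \<and>
        (\<forall>i<n. a i * t \<le> dual_load i z' - dual_load i z) \<and> gain z' - gain z \<le> 12 * t"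
      using s0 by (intro exI[of _ "\<lambda>i. z i + s i"]) auto
  qed
qed

text \<open>Repeat the uniform step. Coverage starts nonnegative and gains \<open>\<rho>\<close>
  each time, so \<open>N\<close> steps with \<open>N * \<rho> \<ge> 1\<close> suffice.\<close>

lemma raise:
  fixes a x :: "nat \<Rightarrow> real"
  assumes x: "\<And>i. i < n \<Longrightarrow> 0 \<le> x i" and xpos: "\<And>i. i < n \<Longrightarrow> costly i \<Longrightarrow> 0 < x i"
    and a: "\<And>i. i < n \<Longrightarrow> 0 \<le> a i" and a0: "\<And>i. i < n \<Longrightarrow> \<not> costly i \<Longrightarrow> a i = 0"
    and aex: "\<exists>i<n. a i \<noteq> 0"
  shows "\<exists>z Y. 0 \<le> Y \<and> (\<forall>i<n. x i \<le> z i) \<and> 1 \<le> (\<Sum>i<n. a i * z i) \<and>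
    (\<forall>i<n. a i * Y \<le> dual_load i z - dual_load i x) \<and> gain z - gain x \<le> 12 * Y"
proof -
  obtain t \<rho> where t: "0 < t" and \<rho>: "0 < \<rho>" and step:
    "\<forall>z. (\<forall>i<n. x i \<le> z i \<and> (a i = 0 \<longrightarrow> z i = x i)) \<longrightarrow>
      (\<Sum>i<n. a i * z i) < 1 \<longrightarrow>
      (\<exists>z'. (\<forall>i<n. z i \<le> z' i \<and> (a i = 0 \<longrightarrow> z' i = x i)) \<and>
        (\<Sum>i<n. a i * z i) + \<rho> \<le> (\<Sum>i<n. a i * z' i) \<and>
        (\<forall>i<n. a i * t \<le> dual_load i z' - dual_load i z) \<and> gain z' - gain z \<le> 12 * t)"
    using uniform_step[of x a, OF x xpos a a0 aex] by blast
  have iter: "\<exists>z Y. 0 \<le> Y \<and> (\<forall>i<n. x i \<le> z i) \<and> (\<forall>i<n. a i = 0 \<longrightarrow> z i = x i) \<and>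
    (1 \<le> (\<Sum>i<n. a i * z i) \<or> (\<Sum>i<n. a i * x i) + real N * \<rho> \<le> (\<Sum>i<n. a i * z i)) \<and>
    (\<forall>i<n. a i * Y \<le> dual_load i z - dual_load i x) \<and> gain z - gain x \<le> 12 * Y" for N
  proof (induction N)
    case 0
    show ?case by (intro exI[of _ x] exI[of _ 0]) auto
  next
    case (Suc N)
    then obtain z Y where z: "0 \<le> Y" "\<And>i. i < n \<Longrightarrow> x i \<le> z i" "\<And>i. i < n \<Longrightarrow> a i = 0 \<Longrightarrow> z i = x i"
      "1 \<le> (\<Sum>i<n. a i * z i) \<or> (\<Sum>i<n. a i * x i) + real N * \<rho> \<le> (\<Sum>i<n. a i * z i)"
      "\<And>i. i < n \<Longrightarrow> a i * Y \<le> dual_load i z - dual_load i x" "gain z - gain x \<le> 12 * Y" by blast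
    show ?case
    proof (cases "1 \<le> (\<Sum>i<n. a i * z i)")
      case True
      then show ?thesis using z by (intro exI[of _ z] exI[of _ Y]) auto
    next
      case False
      have "\<exists>z'. (\<forall>i<n. z i \<le> z' i \<and> (a i = 0 \<longrightarrow> z' i = x i)) \<and>
        (\<Sum>i<n. a i * z i) + \<rho> \<le> (\<Sum>i<n. a i * z' i) \<and>
        (\<forall>i<n. a i * t \<le> dual_load i z' - dual_load i z) \<and> gain z' - gain z \<le> 12 * t"
        by (rule step[THEN spec[of _ z], THEN mp, THEN mp]) (use z(2,3) False in auto)
      then obtain z' where z': "\<And>i. i < n \<Longrightarrow> z i \<le> z' i" "\<And>i. i < n \<Longrightarrow> a i = 0 \<Longrightarrow> z' i = x i"
        "(\<Sum>i<n. a i * z i) + \<rho> \<le> (\<Sum>i<n. a i * z' i)"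
        "\<And>i. i < n \<Longrightarrow> a i * t \<le> dual_load i z' - dual_load i z" "gain z' - gain z \<le> 12 * t"
        by blast
      have "x i \<le> z' i \<and> a i * (Y + t) \<le> dual_load i z' - dual_load i x" if "i < n" for i
        using z(2,5)[OF that] z'(1,4)[OF that] by (simp add: distrib_left)
      moreover have "(\<Sum>i<n. a i * x i) + real (Suc N) * \<rho> \<le> (\<Sum>i<n. a i * z' i)"
        using z'(3) z(4) False by (simp add: distrib_right)
      ultimately show ?thesis using z(1,6) z'(2,5) t
        by (intro exI[of _ z'] exI[of _ "Y + t"]) auto
    qed
  qed
  obtain N :: nat where N: "1 / \<rho> \<le> real N" using real_arch_simple by blast
  then have N: "1 \<le> real N * \<rho>" using \<rho> by (simp add: field_simps)
  have "0 \<le> (\<Sum>i<n. a i * x i)" using a x by (intro sum_nonneg mult_nonneg_nonneg) auto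
  moreover obtain z Y where z: "0 \<le> Y" "\<forall>i<n. x i \<le> z i"
    "1 \<le> (\<Sum>i<n. a i * z i) \<or> (\<Sum>i<n. a i * x i) + real N * \<rho> \<le> (\<Sum>i<n. a i * z i)"
    "\<forall>i<n. a i * Y \<le> dual_load i z - dual_load i x" "gain z - gain x \<le> 12 * Y"
    using iter[of N] by blast
  ultimately have "1 \<le> (\<Sum>i<n. a i * z i)" using N by linarith
  then show ?thesis using z by blast
qed

section \<open>Comparison of \<open>gain\<close> with the cost, and the invariant kept between
  requests\<close>

lemma load_cong: "(\<And>i. i < n \<Longrightarrow> x i = y i) \<Longrightarrow> load k x = load k y"
  by (simp add: load_def)

lemma dual_load_cong: "i < n \<Longrightarrow> (\<And>i. i < n \<Longrightarrow> x i = y i) \<Longrightarrow> dual_load i x = dual_load i y"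
  using load_cong[of x y] by (simp add: dual_load_def)

lemma gain_cong: "(\<And>i. i < n \<Longrightarrow> x i = y i) \<Longrightarrow> gain x = gain y"
  using load_cong[of x y] by (simp add: gain_def gain1_def)

lemma cost_nonneg: "0 \<le> cost x"
  by (simp add: cost_def sum_nonneg)

lemma gain_le: "(\<And>i. i < n \<Longrightarrow> 0 \<le> x i) \<Longrightarrow> gain x \<le> cost x / p"
  unfolding gain_def cost_def sum_divide_distrib by (intro sum_mono gain1_le) auto

lemma gain_ge: "(\<And>i. i < n \<Longrightarrow> 0 \<le> x i) \<Longrightarrow> cost x / (2 * p) \<le> gain x"
  unfolding gain_def cost_def sum_divide_distrib by (intro sum_mono gain1_ge) auto

text \<open>
  The rates vanish at \<open>0\<close>, so the raising process cannot start there, yet the vector has to stay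
  free of cost as long as the optimum is \<open>0\<close>. This is the first alternative; the first request
  that cannot be served for free leads to the second one.
\<close>

definition certified :: "(nat \<Rightarrow> real) set \<Rightarrow> (nat \<Rightarrow> real) \<Rightarrow> bool" where
  "certified F x \<longleftrightarrow> (\<forall>i<n. 0 \<le> x i) \<and>
    ((\<forall>i<n. costly i \<longrightarrow> x i = 0) \<or>
     (\<forall>i<n. costly i \<longrightarrow> 0 < x i) \<and>
     (\<exists>Y\<ge>0. \<forall>y\<in>F. Y \<le> (\<Sum>i<n. y i * dual_load i x) \<and> gain x \<le> 12 * Y + cost y / p))"

text \<open>Needed for turning an index function into a vector, which retains only the entries below
  \<open>n\<close>.\<close>

lemma certified_cong:
  assumes "certified F x" "\<And>i. i < n \<Longrightarrow> x i = y i"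
  shows "certified F y"
  using assms dual_load_cong[of _ x y] gain_cong[of x y] unfolding certified_def by auto

lemma sum_load_eq: "(\<Sum>k<l. w k * load k y) = (\<Sum>i<n. y i * (\<Sum>k<l. c k i * w k))"
  unfolding load_def sum_distrib_left by (subst sum.swap) (simp add: mult_ac)

text \<open>The request has only costly entries, so every \<open>y\<close> in \<open>F\<close> has
  some load at least \<open>t / real l\<close>. Starting all costly coordinates at a tiny
  \<open>\<delta>\<close> keeps the cost below that of every such \<open>y\<close>, so the dual
  value 0 is a valid certificate.\<close>

lemma certified_init:
  assumes x: "\<And>i. i < n \<Longrightarrow> 0 \<le> x i" and x0: "\<And>i. i < n \<Longrightarrow> costly i \<Longrightarrow> x i = 0"
    and a: "\<And>i. i < n \<Longrightarrow> 0 \<le> a i" and a0: "\<And>i. i < n \<Longrightarrow> \<not> costly i \<Longrightarrow> a i = 0"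
    and aex: "\<exists>i<n. a i \<noteq> 0"
    and F: "\<And>y i. y \<in> F \<Longrightarrow> i < n \<Longrightarrow> 0 \<le> y i" "\<And>y. y \<in> F \<Longrightarrow> 1 \<le> (\<Sum>i<n. a i * y i)"
  shows "\<exists>x'. (\<forall>i<n. x i \<le> x' i) \<and> (\<forall>i<n. costly i \<longrightarrow> 0 < x' i) \<and> certified F x'"
proof -
  have lpos: "0 < real l"
  proof -
    obtain i where "costly i" using aex a0 by blast
    then show ?thesis by (auto simp: costly_def)
  qed
  have csum: "0 < (\<Sum>k<l. c k i)" if i: "i < n" "costly i" for i
  proof -
    obtain k where "k < l" "c k i \<noteq> 0" using i by (auto simp: costly_def)
    then show ?thesis using c_nonneg[of _ i] i by (intro sum_pos2[of _ k]) (auto simp: less_le)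
  qed
  \<comment> \<open>With \<open>a i * t\<close> below the column sums, covering the request forces a
    total load of at least \<open>t\<close>.\<close>
  obtain t where t: "0 < t" and ta: "\<forall>i\<in>{i. i < n \<and> costly i}. a i * t \<le> (\<Sum>k<l. c k i)"
    using finite_scaling[of "{i. i < n \<and> costly i}" "\<lambda>i. \<Sum>k<l. c k i" a] csum by auto
  \<comment> \<open>One division by \<open>real l\<close> is for averaging over the rows of
    \<open>y\<close>, the other for summing the rows of the starting vector.\<close>
  define \<eta> where "\<eta> = t / real l / real l"
  have \<eta>: "0 < \<eta>" using t lpos by (simp add: \<eta>_def)
  obtain \<delta> where \<delta>: "0 < \<delta>" and \<delta>l: "\<forall>k\<in>{..<l}. load k (\<lambda>_. 1) * \<delta> \<le> \<eta>"
    using finite_scaling[of "{..<l}" "\<lambda>_. \<eta>" "\<lambda>k. load k (\<lambda>_. 1)"] \<eta> by auto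
  define x' where "x' i = (if costly i then \<delta> else x i)" for i
  have x': "0 \<le> x' i" if "i < n" for i using x[OF that] \<delta> by (simp add: x'_def)
  have load_x': "load k x' \<le> \<eta>" if k: "k < l" for k
  proof -
    have "load k x' = load k (\<lambda>_. 1) * \<delta>"
      unfolding load_def sum_distrib_right using k by (intro sum.cong) (auto simp: x'_def costly_def)
    then show ?thesis using \<delta>l k by simp
  qed
  have cost: "cost x' \<le> cost y" if y: "y \<in> F" for y
  proof -
    have "t * 1 \<le> t * (\<Sum>i<n. a i * y i)" using F(2)[OF y] t by (intro mult_left_mono) auto
    also have "\<dots> = (\<Sum>i<n. y i * (a i * t))" by (simp add: sum_distrib_left mult_ac)
    also have "\<dots> \<le> (\<Sum>i<n. y i * (\<Sum>k<l. c k i * 1))"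
    proof (intro sum_mono mult_left_mono)
      fix i assume "i \<in> {..<n}"
      then show "a i * t \<le> (\<Sum>k<l. c k i * 1)"
        using ta a0[of i] c_nonneg by (cases "costly i") (auto intro!: sum_nonneg)
    qed (use F(1)[OF y] in auto)
    also have "\<dots> = (\<Sum>k<l. load k y)" using sum_load_eq[of "\<lambda>_. 1" y] by simp
    finally have t_le: "t \<le> (\<Sum>k<l. load k y)" by simp
    have "\<exists>k<l. t / real l \<le> load k y"
    proof (rule ccontr)
      assume "\<not> ?thesis"
      then have "(\<Sum>k<l. load k y) < (\<Sum>k<l. t / real l)"
        using lpos by (intro sum_strict_mono) auto
      then show False using t_le lpos by simp
    qed
    then obtain k where k: "k < l" "t / real l \<le> load k y" by blast
    have "cost x' \<le> (\<Sum>k<l. \<eta> powr p)"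
      unfolding cost_def using load_x' x' p_ge_2
      by (intro sum_mono powr_mono2) (auto intro: load_nonneg)
    also have "\<dots> = real l * \<eta> powr p" by simp
    also have "\<dots> \<le> real l powr p * \<eta> powr p"
    proof (intro mult_right_mono)
      have "1 \<le> real l" using lpos by simp
      then show "real l \<le> real l powr p" using powr_mono[of 1 p "real l"] p_ge_2 by simp
    qed simp
    also have "\<dots> = (t / real l) powr p"
      using \<eta> lpos by (simp add: powr_mult[symmetric] \<eta>_def)
    also have "\<dots> \<le> load k y powr p" using k t lpos p_ge_2 by (intro powr_mono2) auto
    also have "\<dots> \<le> cost y"
      unfolding cost_def using k by (intro member_le_sum[of k "{..<l}" "\<lambda>k. load k y powr p"]) auto
    finally show ?thesis .
  qed
  have "certified F x'"
    unfolding certified_def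
  proof (intro conjI disjI2 exI[of _ 0] ballI)
    fix y assume y: "y \<in> F"
    have "0 \<le> dual_load i x'" if "i < n" for i
      unfolding dual_load_def using that x' c_nonneg
      by (intro sum_nonneg mult_nonneg_nonneg psi_nonneg load_nonneg) auto
    then show "0 \<le> (\<Sum>i<n. y i * dual_load i x')"
      using F(1)[OF y] by (intro sum_nonneg mult_nonneg_nonneg) auto
    have "gain x' \<le> cost x' / p" using gain_le[of x'] x' by simp
    also have "\<dots> \<le> cost y / p" using cost[OF y] p_ge_2 by (intro divide_right_mono) auto
    finally show "gain x' \<le> 12 * 0 + cost y / p" by simp
  qed (use x' \<delta> in \<open>auto simp: x'_def\<close>)
  then show ?thesis using x0 \<delta> by (intro exI[of _ x']) (auto simp: x'_def less_imp_le)
qed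

text \<open>The dual value grows by the weight \<open>t\<close> of the new request. Each
  \<open>y\<close> in \<open>F'\<close> covers that request, so weak duality extends to the new
  total, and the old bounds survive because \<open>F'\<close> lies in \<open>F\<close>.\<close>

lemma certified_raise:
  assumes cert: "certified F x" and xpos: "\<And>i. i < n \<Longrightarrow> costly i \<Longrightarrow> 0 < x i"
    and a: "\<And>i. i < n \<Longrightarrow> 0 \<le> a i" and a0: "\<And>i. i < n \<Longrightarrow> \<not> costly i \<Longrightarrow> a i = 0"
    and aex: "\<exists>i<n. a i \<noteq> 0"
    and F: "F' \<subseteq> F" "\<And>y i. y \<in> F' \<Longrightarrow> i < n \<Longrightarrow> 0 \<le> y i" "\<And>y. y \<in> F' \<Longrightarrow> 1 \<le> (\<Sum>i<n. a i * y i)"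
  shows "\<exists>x'. (\<forall>i<n. x i \<le> x' i) \<and> 1 \<le> (\<Sum>i<n. a i * x' i) \<and> certified F' x'"
proof -
  have x: "\<And>i. i < n \<Longrightarrow> 0 \<le> x i" using cert by (simp add: certified_def)
  \<comment> \<open>A positive costly coordinate rules out the first alternative of
    \<open>certified\<close>.\<close>
  obtain i where "i < n" "costly i" using aex a0 by blast
  then obtain Y where Y: "0 \<le> Y" "\<And>y. y \<in> F \<Longrightarrow> Y \<le> (\<Sum>i<n. y i * dual_load i x)"
    "\<And>y. y \<in> F \<Longrightarrow> gain x \<le> 12 * Y + cost y / p"
    using cert xpos[of i] unfolding certified_def by force
  obtain z t where z: "0 \<le> t" "\<And>i. i < n \<Longrightarrow> x i \<le> z i" "1 \<le> (\<Sum>i<n. a i * z i)"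
    "\<And>i. i < n \<Longrightarrow> a i * t \<le> dual_load i z - dual_load i x" "gain z - gain x \<le> 12 * t"
    using raise[of x a, OF x xpos a a0 aex] by blast
  have "certified F' z"
    unfolding certified_def
  proof (intro conjI disjI2 exI[of _ "Y + t"] ballI)
    fix y assume y: "y \<in> F'"
    have "Y + t * 1 \<le> (\<Sum>i<n. y i * dual_load i x) + t * (\<Sum>i<n. a i * y i)"
      using Y(2)[of y] F(1) F(3)[OF y] y z(1) by (intro add_mono mult_left_mono) auto
    also have "\<dots> = (\<Sum>i<n. y i * (dual_load i x + a i * t))"
      by (simp add: sum_distrib_left distrib_left sum.distrib mult_ac)
    also have "\<dots> \<le> (\<Sum>i<n. y i * dual_load i z)"
    proof (intro sum_mono mult_left_mono)
      fix i assume "i \<in> {..<n}"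
      then show "dual_load i x + a i * t \<le> dual_load i z" using z(4)[of i] by simp
    qed (use F(2)[OF y] in auto)
    finally show "Y + t \<le> (\<Sum>i<n. y i * dual_load i z)" by simp
    show "gain z \<le> 12 * (Y + t) + cost y / p" using Y(3)[of y] F(1) y z(5) by auto
  next
    show "\<forall>i<n. 0 \<le> z i" using x z(2) order_trans by blast
    show "\<forall>i<n. costly i \<longrightarrow> 0 < z i" using xpos z(2) less_le_trans by blast
  qed (use Y z in auto)
  then show ?thesis using z by blast
qed

lemma certified_step:
  assumes cert: "certified F x" and a: "\<And>i. i < n \<Longrightarrow> 0 \<le> a i" and aex: "\<exists>i<n. a i \<noteq> 0"
    and F: "F' \<subseteq> F" "\<And>y i. y \<in> F' \<Longrightarrow> i < n \<Longrightarrow> 0 \<le> y i" "\<And>y. y \<in> F' \<Longrightarrow> 1 \<le> (\<Sum>i<n. a i * y i)"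
  shows "\<exists>x'. (\<forall>i<n. x i \<le> x' i) \<and> 1 \<le> (\<Sum>i<n. a i * x' i) \<and> certified F' x'"
proof (cases "\<exists>i<n. \<not> costly i \<and> a i \<noteq> 0")
  case True
  then obtain j where j: "j < n" "\<not> costly j" "a j \<noteq> 0" by blast
  have aj: "0 < a j" using a[OF j(1)] j by simp
  have x: "\<And>i. i < n \<Longrightarrow> 0 \<le> x i" using cert by (simp add: certified_def)
  let ?x' = "x(j := x j + 1 / a j)"
  have c0: "c k j = 0" if "k < l" for k using j that by (auto simp: costly_def)
  have part: "c k i * ?x' i = c k i * x i" if "k < l" for k i using c0[OF that] by auto
  have load: "load k ?x' = load k x" if "k < l" for k
    unfolding load_def by (simp only: part[OF that])
  have dual: "dual_load i ?x' = dual_load i x" for i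
    unfolding dual_load_def by (intro sum.cong) (simp_all only: part load lessThan_iff)
  have gain: "gain ?x' = gain x"
    unfolding gain_def gain1_def by (intro sum.cong) (simp_all only: part load lessThan_iff)
  have "certified F ?x'"
    using cert j aj unfolding certified_def dual gain by (auto simp: add_nonneg_pos less_imp_le)
  then have "certified F' ?x'" using F(1) unfolding certified_def by blast
  moreover have "1 \<le> (\<Sum>i<n. a i * ?x' i)"
  proof -
    have "1 \<le> a j * ?x' j" using aj x[OF j(1)] by (simp add: distrib_left)
    also have "\<dots> \<le> (\<Sum>i<n. a i * ?x' i)"
      using j a x aj by (intro member_le_sum[of j "{..<n}" "\<lambda>i. a i * ?x' i"]) auto
    finally show ?thesis .
  qed
  ultimately show ?thesis using aj by (intro exI[of _ ?x']) auto
next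
  case False
  then have a0: "\<And>i. i < n \<Longrightarrow> \<not> costly i \<Longrightarrow> a i = 0" by blast
  have x: "\<And>i. i < n \<Longrightarrow> 0 \<le> x i" using cert by (simp add: certified_def)
  consider "\<And>i. i < n \<Longrightarrow> costly i \<Longrightarrow> x i = 0" | "\<And>i. i < n \<Longrightarrow> costly i \<Longrightarrow> 0 < x i"
    using cert unfolding certified_def by blast
  then show ?thesis
  proof cases
    case 1
    \<comment> \<open>The starting certificate already refers to \<open>F'\<close>, since its lower
      bound on the cost comes from the new request.\<close>
    have "\<exists>x'. (\<forall>i<n. x i \<le> x' i) \<and> (\<forall>i<n. costly i \<longrightarrow> 0 < x' i) \<and> certified F' x'"
      by (rule certified_init[of x a F', OF x 1 a a0 aex]) (use F in auto)
    then obtain x' where x': "\<And>i. i < n \<Longrightarrow> x i \<le> x' i"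
      "\<And>i. i < n \<Longrightarrow> costly i \<Longrightarrow> 0 < x' i" "certified F' x'" by blast
    have "\<exists>x''. (\<forall>i<n. x' i \<le> x'' i) \<and> 1 \<le> (\<Sum>i<n. a i * x'' i) \<and> certified F' x''"
      by (rule certified_raise[of F' x' a F', OF x'(3,2) a a0 aex order_refl]) (use F in auto)
    then show ?thesis using x'(1) order_trans by blast
  next
    case 2
    show ?thesis by (rule certified_raise[of F x a F', OF cert 2 a a0 aex F(1)]) (use F in auto)
  qed
qed

section \<open>The competitive ratio\<close>

text \<open>Up to a factor \<open>2 * p\<close>, the cost is at most \<open>gain\<close>, hence
  bounded by the dual value. By \<open>psi_le\<close> the latter is a mixed sum of
  \<open>load k x powr (p - 1)\<close> and \<open>load k y\<close>, which Young's inequality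
  separates.\<close>

lemma certified_cost_le:
  assumes cert: "certified F x" and y: "y \<in> F" "\<And>i. i < n \<Longrightarrow> 0 \<le> y i"
  shows "cost x \<le> (672 * p * ln (real d)) powr p * cost y"
proof (cases "\<forall>i<n. costly i \<longrightarrow> x i = 0")
  case True
  have "load k x = 0" if "k < l" for k
    unfolding load_def using True that by (intro sum.neutral) (auto simp: costly_def)
  then have "cost x = 0" by (simp add: cost_def)
  then show ?thesis by (simp add: cost_nonneg)
next
  case False
  then obtain Y where Y: "0 \<le> Y" "Y \<le> (\<Sum>i<n. y i * dual_load i x)" "gain x \<le> 12 * Y + cost y / p"
    using cert y(1) unfolding certified_def by blast
  have x: "\<And>i. i < n \<Longrightarrow> 0 \<le> x i" using cert by (simp add: certified_def)
  define B where "B = 2 + ln (1 + 2 * real d)"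
  \<comment> \<open>Twice the factor \<open>24 * p * B\<close> of the mixed sum: the spare 1/2
    leaves only half of \<open>cost x\<close> on the right, to be absorbed on the left.\<close>
  define M where "M = 48 * p * B"
  have B: "2 \<le> B" by (simp add: B_def)
  have M: "4 \<le> M"
  proof -
    have "2 * 2 \<le> p * B" using p_ge_2 B by (intro mult_mono) auto
    then have "4 \<le> 48 * (p * B)" by linarith
    then show ?thesis by (simp only: M_def mult.assoc)
  qed
  have lx: "0 \<le> load k x" and ly: "0 \<le> load k y" if "k < l" for k
    using that x y by (auto intro: load_nonneg)
  have "Y \<le> (\<Sum>i<n. y i * dual_load i x)" by (fact Y(2))
  also have "\<dots> \<le> (\<Sum>i<n. y i * (\<Sum>k<l. c k i * (load k x powr (p - 1) * B)))"
    unfolding dual_load_def B_def using x y lx c_nonneg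
    by (intro sum_mono mult_left_mono psi_le mult_nonneg_nonneg) auto
  also have "\<dots> = (\<Sum>k<l. load k x powr (p - 1) * B * load k y)" by (rule sum_load_eq[symmetric])
  finally have YB: "Y \<le> (\<Sum>k<l. load k x powr (p - 1) * B * load k y)" .
  have "cost x \<le> 2 * p * gain x" using gain_ge[of x] x p_ge_2 by (simp add: field_simps)
  also have "\<dots> \<le> 2 * p * (12 * Y + cost y / p)" using Y p_ge_2 by (intro mult_left_mono) auto
  also have "\<dots> = 24 * p * Y + 2 * cost y" using p_ge_2 by (simp add: algebra_simps)
  finally have cx: "cost x \<le> 24 * p * Y + 2 * cost y" .
  have "24 * p * Y \<le> 24 * p * (\<Sum>k<l. load k x powr (p - 1) * B * load k y)"
    using YB p_ge_2 by (intro mult_left_mono) auto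
  also have "\<dots> = (\<Sum>k<l. load k x powr (p - 1) * (M * load k y)) / 2"
    by (simp add: M_def sum_distrib_left sum_divide_distrib mult_ac)
  also have "\<dots> \<le> (\<Sum>k<l. load k x powr p + (M * load k y) powr p) / 2"
    using lx ly M p_ge_2 by (intro divide_right_mono sum_mono powr_mult_le_add_powr) auto
  also have "(\<Sum>k<l. load k x powr p + (M * load k y) powr p) = cost x + M powr p * cost y"
    using ly M by (simp add: cost_def sum.distrib sum_distrib_left powr_mult)
  finally have "cost x \<le> M powr p * cost y + 4 * cost y" using cx by simp
  also have "\<dots> \<le> M powr p * cost y + M powr p * cost y"
  proof (intro add_left_mono mult_right_mono cost_nonneg)
    have "M powr 1 \<le> M powr p" using M p_ge_2 by (intro powr_mono) auto
    then show "4 \<le> M powr p" using M by simp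
  qed
  also have "\<dots> = 2 * M powr p * cost y" by simp
  also have "\<dots> \<le> 2 powr p * M powr p * cost y"
    using powr_mono[of 1 p 2] p_ge_2 by (intro mult_right_mono cost_nonneg) auto
  also have "\<dots> = (2 * M) powr p * cost y" using M by (simp add: powr_mult)
  also have "\<dots> \<le> (672 * p * ln (real d)) powr p * cost y"
  proof (intro mult_right_mono cost_nonneg powr_mono2)
    \<comment> \<open>Hence \<open>2 \<le> 4 * ln (real d)\<close>; together with
      \<open>1 + 2 * real d \<le> real d ^ 3\<close> this gives
      \<open>B \<le> 7 * ln (real d)\<close>, and \<open>96 * 7 = 672\<close>.\<close>
    have ln2: "1 / 2 \<le> ln (2::real)" using ln_le_minus_one[of "1 / 2 :: real"] by (simp add: ln_div)
    have lnd: "ln 2 \<le> ln (real d)" using d_ge_2 by simp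
    have d: "2 \<le> real d" using d_ge_2 by simp
    have "2 * 2 \<le> real d * real d" using mult_mono[OF d d] by simp
    then have "2 * 2 * real d \<le> real d * real d * real d" by (intro mult_right_mono) auto
    then have "1 + 2 * real d \<le> real d ^ 3" using d unfolding power3_eq_cube by linarith
    then have "ln (1 + 2 * real d) \<le> ln (real d ^ 3)" using d_ge_2 by (subst ln_le_cancel_iff) auto
    also have "\<dots> = 3 * ln (real d)" using d_ge_2 by (simp add: ln_realpow)
    finally have "B \<le> 7 * ln (real d)" using ln2 lnd by (simp add: B_def)
    then have "96 * p * B \<le> 96 * p * (7 * ln (real d))" using p_ge_2 by (intro mult_left_mono) auto
    then show "2 * M \<le> 672 * p * ln (real d)" by (simp add: M_def)
  qed (use M p_ge_2 in auto)
  finally show ?thesis .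
qed

end

section \<open>From one-step existence to an online algorithm and its ratio\<close>

lemma online_algorithm_exists:
  assumes init: "P [] x0"
    and step: "\<And>as a x. valid (as @ [a]) \<Longrightarrow> P as x \<Longrightarrow> \<exists>x'. Q a x x' \<and> P (as @ [a]) x'"
    and prefix: "\<And>as a. valid (as @ [a]) \<Longrightarrow> valid as"
  shows "\<exists>A. A [] = x0 \<and> (\<forall>as. valid as \<longrightarrow> P as (A as)) \<and>
    (\<forall>as a. valid (as @ [a]) \<longrightarrow> Q a (A as) (A (as @ [a])))"
proof -
  \<comment> \<open>The recursion runs over the reversed prefix, so that the newest request is at
    the head.\<close>
  define B where "B = rec_list x0 (\<lambda>a r x. SOME x'. Q a x x' \<and> P (rev r @ [a]) x')"
  define A where "A as = B (rev as)" for as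
  have A_snoc: "A (as @ [a]) = (SOME x'. Q a (A as) x' \<and> P (as @ [a]) x')" for as a
    by (simp add: A_def B_def)
  have next_ok: "Q a (A as) (A (as @ [a])) \<and> P (as @ [a]) (A (as @ [a]))"
    if "valid (as @ [a])" "P as (A as)" for as a
    unfolding A_snoc using step[OF that] by (rule someI_ex)
  have A_Nil: "A [] = x0" by (simp add: A_def B_def)
  have "valid as \<longrightarrow> P as (A as)" for as
    by (induction as rule: rev_induct) (use init A_Nil next_ok prefix in auto)
  then show ?thesis using next_ok prefix A_Nil by blast
qed

text \<open>Comparison with each feasible point passes to the infimum once the feasible set is known
  to be nonempty.\<close>

lemma competitiveI:
  assumes "0 < \<alpha>"
    and "\<And>as x. covering_instance n as \<Longrightarrow> x \<in> covering_feasible n as \<Longrightarrow> f (A as) \<le> \<alpha> * f x"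
  shows "competitive n f \<alpha> A"
  unfolding competitive_def
proof (intro allI impI)
  fix as assume inst: "covering_instance n as"
  define w :: "real vec \<Rightarrow> real" where "w a = (\<Sum>i<n. a $ i)" for a
  have feas: "covering_feasible n as \<noteq> {}"
  proof -
    have w: "0 < w a" if "a \<in> set as" for a
    proof -
      have a: "a \<in> carrier_vec n" "0\<^sub>v n \<le> a" "a \<noteq> 0\<^sub>v n"
        using inst that by (auto simp: covering_instance_def nonneg_vec_def)
      then have nn: "\<And>i. i < n \<Longrightarrow> 0 \<le> a $ i" by (auto simp: less_eq_vec_def)
      obtain i where "i < n" "a $ i \<noteq> 0" using a by (metis carrier_vecD eq_vecI index_zero_vec)
      then show ?thesis unfolding w_def using nn by (intro sum_pos2[of _ i]) (auto simp: less_le)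
    qed
    \<comment> \<open>With \<open>t\<close> below all coordinate sums, the constant vector with
      entries \<open>1 / t\<close> is feasible.\<close>
    obtain t where t: "0 < t" "\<forall>a\<in>set as. 1 * t \<le> w a"
      using finite_scaling[of "set as" w "\<lambda>_. 1"] w by auto
    have "1 \<le> a \<bullet> vec n (\<lambda>_. 1 / t)" if "a \<in> set as" for a
    proof -
      have "a \<bullet> vec n (\<lambda>_. 1 / t) = w a / t"
        by (simp add: scalar_prod_def w_def sum_divide_distrib atLeast0LessThan)
      then show ?thesis using t that by simp
    qed
    then have "vec n (\<lambda>_. 1 / t) \<in> covering_feasible n as"
      using t by (simp add: covering_feasible_def nonneg_vec_def less_eq_vec_def)
    then show ?thesis by blast
  qed
  have "f (A as) / \<alpha> \<le> opt_cost n f as"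
    unfolding opt_cost_def using assms(2)[OF inst] assms(1)
    by (intro cINF_greatest[OF feas]) (simp add: divide_le_eq mult.commute)
  then show "f (A as) \<le> \<alpha> * opt_cost n f as"
    using assms(1) by (simp add: divide_le_eq mult.commute)
qed

theorem corollary3p1:
  shows "\<exists>C>0::real. \<forall>(n::nat) (l::nat) (d::nat) (c :: nat \<Rightarrow> real vec) (p::real).
    2 \<le> d \<longrightarrow> 2 \<le> p \<longrightarrow>
    (\<forall>k<l. c k \<in> nonneg_vec n \<and> card {i. i < n \<and> c k $ i \<noteq> 0} \<le> d) \<longrightarrow>
    (\<exists>A. online_covering_algorithm n A \<and>
       competitive n (\<lambda>x. \<Sum>k<l. (linear_loads l c x $ k) powr p) ((C * p * ln (real d)) powr p) A) \<and>
    (\<exists>A. online_covering_algorithm n A \<and>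
       competitive n (\<lambda>x. p_norm p (linear_loads l c x)) (C * p * ln (real d)) A)"
proof (rule exI[of _ 672], rule conjI, simp, intro allI impI)
  fix n l d :: nat and c :: "nat \<Rightarrow> real vec" and p :: real
  assume d: "2 \<le> d" and p: "2 \<le> p"
    and c: "\<forall>k<l. c k \<in> nonneg_vec n \<and> card {i. i < n \<and> c k $ i \<noteq> 0} \<le> d"
  have c_ge: "0 \<le> c k $ i" if "k < l" "i < n" for k i
  proof -
    have "0\<^sub>v n \<le> c k" "c k \<in> carrier_vec n" using c that by (auto simp: nonneg_vec_def)
    then show ?thesis using that by (auto simp: less_eq_vec_def)
  qed
  have card: "card {i. i < n \<and> c k $ i \<noteq> 0} \<le> d" if "k < l" for k using c that by blast
  interpret power_load n l d "\<lambda>k i. c k $ i" p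
    by (rule power_load.intro[OF d p c_ge card])
  let ?F = "\<lambda>as. vec_index ` covering_feasible n as"
  let ?\<alpha> = "672 * p * ln (real d)"
  have \<alpha>: "0 < ?\<alpha>" using d p by simp
  have nn: "x \<in> nonneg_vec n \<longleftrightarrow> x \<in> carrier_vec n \<and> (\<forall>i<n. 0 \<le> x $ i)" for x
    by (auto simp: nonneg_vec_def less_eq_vec_def)
  have dot: "a \<bullet> x = (\<Sum>i<n. a $ i * x $ i)" if "x \<in> carrier_vec n" for a x :: "real vec"
    using that by (auto simp: scalar_prod_def atLeast0LessThan)
  have loads: "linear_loads l c x $ k = load k (vec_index x)" if "x \<in> carrier_vec n" "k < l" for x k
    using that dot by (simp add: linear_loads_def load_def)
  have cost_eq: "(\<Sum>k<l. (linear_loads l c x $ k) powr p) = cost (vec_index x)" if "x \<in> carrier_vec n" for x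
    unfolding cost_def using loads[OF that] by simp
  have norm_eq: "p_norm p (linear_loads l c x) = cost (vec_index x) powr (1 / p)" if "x \<in> nonneg_vec n" for x
  proof -
    have "\<bar>linear_loads l c x $ k\<bar> = load k (vec_index x)" if "k < l" for k
      using \<open>x \<in> nonneg_vec n\<close> that nn load_nonneg[of k "vec_index x"] loads[of x k] by auto
    then show ?thesis by (simp add: p_norm_def cost_def linear_loads_def)
  qed
  \<comment> \<open>A single algorithm, built from the invariant \<open>certified\<close>, serves
    both cost functions.\<close>
  have "\<exists>A. A [] = 0\<^sub>v n \<and>
      (\<forall>as. covering_instance n as \<longrightarrow> A as \<in> nonneg_vec n \<and> certified (?F as) (vec_index (A as))) \<and>
      (\<forall>as a. covering_instance n (as @ [a]) \<longrightarrow> A as \<le> A (as @ [a]) \<and> 1 \<le> a \<bullet> A (as @ [a]))"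
  proof (rule online_algorithm_exists)
    show "0\<^sub>v n \<in> nonneg_vec n \<and> certified (?F []) (vec_index (0\<^sub>v n))"
      by (auto simp: nn certified_def)
  next
    fix as a x
    assume inst: "covering_instance n (as @ [a])"
      and x: "x \<in> nonneg_vec n \<and> certified (?F as) (vec_index x)"
    have a: "a \<in> nonneg_vec n" "a \<noteq> 0\<^sub>v n" using inst by (auto simp: covering_instance_def)
    then have aex: "\<exists>i<n. a $ i \<noteq> 0" by (metis carrier_vecD eq_vecI index_zero_vec nn)
    have sub: "?F (as @ [a]) \<subseteq> ?F as" by (auto simp: covering_feasible_def)
    have "\<exists>x'. (\<forall>i<n. x $ i \<le> x' i) \<and> 1 \<le> (\<Sum>i<n. a $ i * x' i) \<and> certified (?F (as @ [a])) x'"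
    proof (rule certified_step)
      show "certified (?F as) (vec_index x)" using x by blast
      show "0 \<le> a $ i" if "i < n" for i using a(1) that by (simp add: nn)
      show "?F (as @ [a]) \<subseteq> ?F as" by (fact sub)
      show "\<exists>i<n. a $ i \<noteq> 0" by (fact aex)
    next
      fix y assume "y \<in> ?F (as @ [a])"
      then obtain v where v: "y = vec_index v" "v \<in> nonneg_vec n" "1 \<le> a \<bullet> v"
        by (auto simp: covering_feasible_def)
      show "0 \<le> y i" if "i < n" for i using v(1,2) that by (simp add: nn)
      show "1 \<le> (\<Sum>i<n. a $ i * y i)" using v dot[of v a] by (simp add: nn)
    qed
    then obtain x' where x': "\<forall>i<n. x $ i \<le> x' i" "1 \<le> (\<Sum>i<n. a $ i * x' i)"
      "certified (?F (as @ [a])) x'" by blast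
    have "certified (?F (as @ [a])) (vec_index (vec n x'))"
      using x'(3) by (rule certified_cong) simp
    moreover have "x \<le> vec n x'" using x x'(1) by (simp add: nn less_eq_vec_def)
    moreover have "1 \<le> a \<bullet> vec n x'" using x'(2) by (simp add: dot)
    moreover have "vec n x' \<in> nonneg_vec n" using x'(3) by (simp add: nn certified_def)
    ultimately show "\<exists>x'. (x \<le> x' \<and> 1 \<le> a \<bullet> x') \<and> x' \<in> nonneg_vec n \<and> certified (?F (as @ [a])) (vec_index x')"
      by blast
  qed (auto simp: covering_instance_def)
  then obtain A where A: "A [] = 0\<^sub>v n"
    "\<And>as. covering_instance n as \<Longrightarrow> A as \<in> nonneg_vec n"
    "\<And>as. covering_instance n as \<Longrightarrow> certified (?F as) (vec_index (A as))"
    "\<And>as a. covering_instance n (as @ [a]) \<Longrightarrow> A as \<le> A (as @ [a])"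
    "\<And>as a. covering_instance n (as @ [a]) \<Longrightarrow> 1 \<le> a \<bullet> A (as @ [a])" by blast
  have online: "online_covering_algorithm n A"
    using A by (auto simp: online_covering_algorithm_def nn)
  have le: "cost (vec_index (A as)) \<le> ?\<alpha> powr p * cost (vec_index x)"
    if "covering_instance n as" "x \<in> covering_feasible n as" for as x
    using that A(3) by (intro certified_cost_le[of "?F as"]) (auto simp: covering_feasible_def nn)
  have carr: "A as \<in> carrier_vec n" if "covering_instance n as" for as
    using A(2)[OF that] by (simp add: nn)
  have feas: "x \<in> carrier_vec n" "x \<in> nonneg_vec n" if "x \<in> covering_feasible n as" for x as
    using that by (auto simp: covering_feasible_def nn)
  have "competitive n (\<lambda>x. \<Sum>k<l. (linear_loads l c x $ k) powr p) (?\<alpha> powr p) A"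
  proof (rule competitiveI)
    show "0 < ?\<alpha> powr p" using \<alpha> by (subst powr_gt_zero) linarith
    show "(\<Sum>k<l. (linear_loads l c (A as) $ k) powr p) \<le> ?\<alpha> powr p * (\<Sum>k<l. (linear_loads l c x $ k) powr p)"
      if "covering_instance n as" "x \<in> covering_feasible n as" for as x
      unfolding cost_eq[OF carr[OF that(1)]] cost_eq[OF feas(1)[OF that(2)]] by (rule le[OF that])
  qed
  moreover have "competitive n (\<lambda>x. p_norm p (linear_loads l c x)) ?\<alpha> A"
  proof (rule competitiveI[OF \<alpha>])
    fix as x assume *: "covering_instance n as" "x \<in> covering_feasible n as"
    \<comment> \<open>The bound for the norm is the \<open>p\<close>-th root of the bound for the
      sum of powers.\<close>
    have "cost (vec_index (A as)) powr (1 / p) \<le> (?\<alpha> powr p * cost (vec_index x)) powr (1 / p)"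
      using le[OF *] p cost_nonneg by (intro powr_mono2) auto
    also have "\<dots> = ?\<alpha> * cost (vec_index x) powr (1 / p)"
      using p d cost_nonneg by (simp add: powr_mult powr_powr abs_of_pos)
    finally show "p_norm p (linear_loads l c (A as)) \<le> ?\<alpha> * p_norm p (linear_loads l c x)"
      using * A(2) feas by (simp add: norm_eq)
  qed
  ultimately show "(\<exists>A. online_covering_algorithm n A \<and>
       competitive n (\<lambda>x. \<Sum>k<l. (linear_loads l c x $ k) powr p) (?\<alpha> powr p) A) \<and>
    (\<exists>A. online_covering_algorithm n A \<and>
       competitive n (\<lambda>x. p_norm p (linear_loads l c x)) ?\<alpha> A)"
    using online by blast
qed

end
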